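(* Let $(m,r)\in\mathcal R_1$ and $(m',r')\in\mathcal R$ be such that $$\frac{-r}{1-m}<m'-r'\le\min\Bigl(\frac rm,1\Bigr)\quad\text{and}\quad r'\ge\frac{r}{1-m}.$$ Then there exists a (strictly) stationary INAR(1) process $\{X_t\}$ with parameters $(m,r)$ and with a BerG$(m',r')$ marginal distribution. The innovation sequence $\{\epsilon_t\}$ has a marginal distribution that is the convolution of a BerG$(m_1,r_1)$ distribution and a BerG$(m_2,r_2)$ distribution, where $$(m_1,r_1)=(r,r)+(r'-m')(m-1,m)\quad\text{and}\quad(m_2,r_2)=(r'(1-m)-r,\;r')$$ (BerG$(m_2,r_2)$ being degenerate at $0$ if $r'=\frac{r}{1-m}$).
   Context: $\mathcal R=\{(m,r)\in\mathbb R^2: r\ge 0,\ 0<m\le r+1\}$ and $\mathcal R_1=\{(m,r)\in\mathbb R^2: r\ge 0,\ 0<m<1\}$. For $(m,r)\in\mathcal R$, $\psi_{m,r}(s)=1-m\frac{1-s}{1+r(1-s)}$, $s\in[0,1]$ (a probability generating function, pgf); BerG$(m,r)$ is the distribution on $\mathbb Z_+$ with pgf $\psi_{m,r}$ (for $m=0$ the same formula gives the distribution degenerate at $0$). For $(m,r)\in\mathcal R_1$, an INAR(1) process with parameters $(m,r)$ is a sequence $(X_t,t\ge0)$ of $\mathbb Z_+$-valued random variables such that for every $t\ge1$, $$X_t=\sum_{i=1}^{X_{t-1}}Z_{i,t-1}+\epsilon_t,$$ where $(Z_{i,t})$ is an array of iid $\mathbb Z_+$-valued random variables with common pgf $\psi_{m,r}$,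 $(\epsilon_t,t\ge1)$ is an iid sequence of $\mathbb Z_+$-valued random variables (the innovation sequence), and $X_0$, $(\epsilon_t)$ and $(Z_{i,t})$ are mutually independent. *)

theory Defs
  imports "HOL-Probability.Probability"
begin

definition param_R :: "(real \<times> real) set" where
  "param_R = {(m, r). 0 \<le> r \<and> 0 < m \<and> m \<le> r + 1}"

definition param_R1 :: "(real \<times> real) set" where
  "param_R1 = {(m, r). 0 \<le> r \<and> 0 < m \<and> m < 1}"

definition psi :: "real \<Rightarrow> real \<Rightarrow> real \<Rightarrow> real" where
  "psi m r s = 1 - m * ((1 - s) / (1 + r * (1 - s)))"

definition pgf :: "nat measure \<Rightarrow> real \<Rightarrow> real" where
  "pgf N s = (\<integral>k. s ^ k \<partial>N)"

text \<open>
  The description below is proper for all \<open>r \<ge> 0\<close> and \<open>0 \<le> m \<le> r + 1\<close>; see \<open>pgf_BerG\<close>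
  (existence) and \<open>pgf_eq_imp_eq\<close> (uniqueness).
\<close>
definition BerG :: "real \<Rightarrow> real \<Rightarrow> nat pmf" where
  "BerG m r = (THE p. \<forall>s\<in>{0..1}. pgf (measure_pmf p) s = psi m r s)"

definition convolution_pmf :: "nat pmf \<Rightarrow> nat pmf \<Rightarrow> nat pmf" where
  "convolution_pmf p q = map_pmf (\<lambda>(x, y). x + y) (pair_pmf p q)"

definition law :: "'a measure \<Rightarrow> ('a \<Rightarrow> nat) \<Rightarrow> nat measure" where
  "law M Y = distr M (count_space UNIV) Y"

text \<open>
  Labels for the variables driving an INAR(1) process: the initial value \<open>X\<^sub>0\<close>, the innovation
  \<open>\<epsilon>\<^sub>t\<close> at time \<open>t \<ge> 1\<close>, and the count \<open>Z\<^sub>i\<^sub>,\<^sub>t\<close> with \<open>i \<ge> 1\<close>, \<open>t \<ge> 0\<close>.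
\<close>
datatype source = Initial | Innovation nat | Offspring nat nat

definition sources :: "source set" where
  "sources = {Initial} \<union> Innovation ` {1..} \<union> {Offspring i t | i t. i \<ge> 1}"

fun driving ::
  "(nat \<Rightarrow> 'a \<Rightarrow> nat) \<Rightarrow> (nat \<Rightarrow> nat \<Rightarrow> 'a \<Rightarrow> nat) \<Rightarrow> (nat \<Rightarrow> 'a \<Rightarrow> nat) \<Rightarrow> source \<Rightarrow> 'a \<Rightarrow> nat"
where
  "driving X Z e Initial = X 0"
| "driving X Z e (Innovation t) = e t"
| "driving X Z e (Offspring i t) = Z i t"

text \<open>
  Independence of the whole family \<open>driving X Z e\<close> over \<open>sources\<close> says at once that the \<open>Z i t\<close>
  are independent, that the \<open>e t\<close> are independent, and that \<open>X 0\<close>, \<open>e\<close> and \<open>Z\<close> are mutually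
  independent.  The values of \<open>Z 0 t\<close> and \<open>e 0\<close> are irrelevant.
\<close>
definition INAR1 ::
  "real \<Rightarrow> real \<Rightarrow> 'a measure \<Rightarrow> (nat \<Rightarrow> 'a \<Rightarrow> nat) \<Rightarrow> (nat \<Rightarrow> nat \<Rightarrow> 'a \<Rightarrow> nat) \<Rightarrow> (nat \<Rightarrow> 'a \<Rightarrow> nat) \<Rightarrow> bool"
where
  "INAR1 m r M X Z e \<longleftrightarrow>
     prob_space M \<and>
     (\<forall>t. X t \<in> measurable M (count_space UNIV)) \<and>
     prob_space.indep_vars M (\<lambda>_. count_space UNIV) (driving X Z e) sources \<and>
     (\<forall>i\<ge>1. \<forall>t. \<forall>s\<in>{0..1}. pgf (law M (Z i t)) s = psi m r s) \<and>
     (\<forall>t\<ge>1. law M (e t) = law M (e 1)) \<and>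
     (\<forall>t\<ge>1. \<forall>\<omega>\<in>space M. X t \<omega> = (\<Sum>i=1..X (t - 1) \<omega>. Z i (t - 1) \<omega>) + e t \<omega>)"

definition strictly_stationary :: "'a measure \<Rightarrow> (nat \<Rightarrow> 'a \<Rightarrow> nat) \<Rightarrow> bool" where
  "strictly_stationary M X \<longleftrightarrow>
     (\<forall>J h. finite J \<longrightarrow>
        distr M (Pi\<^sub>M J (\<lambda>_. count_space UNIV)) (\<lambda>\<omega>. \<lambda>t\<in>J. X (t + h) \<omega>) =
        distr M (Pi\<^sub>M J (\<lambda>_. count_space UNIV)) (\<lambda>\<omega>. \<lambda>t\<in>J. X t \<omega>))"


lemma pgf_sums:
  fixes s :: real
  assumes "0 \<le> s" "s \<le> 1"
  shows "(\<lambda>k. pmf p k * s ^ k) sums pgf (measure_pmf p) s"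
proof -
  have "integrable (measure_pmf p) (\<lambda>k. s ^ k)"
    by (rule measure_pmf.integrable_const_bound[where B = 1])
       (use assms in \<open>auto simp: power_le_one abs_of_nonneg\<close>)
  hence *: "integrable (count_space UNIV) (\<lambda>k. pmf p k * s ^ k)"
    by (subst (asm) measure_pmf_eq_density, subst (asm) integrable_density) auto
  have "pgf (measure_pmf p) s = (\<integral>k. pmf p k * s ^ k \<partial>count_space UNIV)"
    unfolding pgf_def by (subst measure_pmf_eq_density, subst integral_density) auto
  with sums_integral_count_space_nat[OF *] show ?thesis
    by simp
qed

lemma pgf_eq_imp_eq:
  assumes eq: "\<And>s. 0 \<le> s \<Longrightarrow> s \<le> 1 \<Longrightarrow> pgf (measure_pmf p) s = pgf (measure_pmf q) s"
  shows "p = q"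
proof (rule pmf_eqI)
  define d where "d k = pmf p k - pmf q k" for k
  have d_sums: "(\<lambda>k. d k * s ^ k) sums 0" if "0 \<le> s" "s \<le> 1" for s
    using sums_diff[OF pgf_sums[OF that, of p] pgf_sums[OF that, of q]] eq[OF that]
    by (simp add: d_def algebra_simps)
  have "d k = 0" for k
  proof (induction k rule: less_induct)
    case (less k)
    have shifted: "(\<lambda>n. d (n + k) * s ^ n) sums 0" if "0 < s" "s \<le> 1" for s
    proof -
      have "(\<lambda>n. d (n + k) * s ^ (n + k)) sums (0 - (\<Sum>n<k. d n * s ^ n))"
        using sums_split_initial_segment[OF d_sums, of s k] that by simp
      also have "(\<Sum>n<k. d n * s ^ n) = 0"
        using less by (intro sum.neutral) auto
      finally have "(\<lambda>n. (d (n + k) * s ^ (n + k)) / s ^ k) sums (0 / s ^ k)"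
        by (intro sums_divide) simp
      thus ?thesis using that by (simp add: power_add)
    qed
    have abs: "summable (\<lambda>n. d (n + k) * s ^ n)" if "norm s < 1" for s
      using powser_inside[OF sums_summable[OF shifted[of 1]], of s] that by simp
    have "((\<lambda>s. \<Sum>n. d (n + k) * s ^ n) \<longlongrightarrow> d (0 + k)) (at 0)"
      by (rule powser_limit_0_strong[where a = "\<lambda>n. d (n + k)" and s = 1])
         (use abs in auto)
    hence "((\<lambda>s. \<Sum>n. d (n + k) * s ^ n) \<longlongrightarrow> d k) (at_right 0)"
      by (simp add: filterlim_at_split)
    moreover have "eventually (\<lambda>s. (\<Sum>n. d (n + k) * s ^ n) = 0) (at_right 0)"
      using eventually_at_right_less[of 0] eventually_at_right_real[OF zero_less_one]
      by eventually_elim (use shifted in \<open>auto intro!: sums_unique[symmetric]\<close>)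
    ultimately have "((\<lambda>_. 0) \<longlongrightarrow> d k) (at_right (0::real))"
      using tendsto_cong by fastforce
    thus ?case by (simp add: tendsto_const_iff)
  qed
  thus "pmf p k = pmf q k" for k by (simp add: d_def)
qed

lemma pgf_BerG:
  assumes "0 \<le> r" "0 \<le> m" "m \<le> r + 1" "0 \<le> s" "s \<le> 1"
  shows "pgf (measure_pmf (BerG m r)) s = psi m r s"
proof -
  define c where "c = r / (1 + r)"
  define f where
    "f k = (if k = 0 then 1 - m / (1 + r) else m / (1 + r)\<^sup>2 * c ^ (k - 1))" for k :: nat
  have c: "0 \<le> c" "c < 1" using assms by (auto simp: c_def)
  have f_nonneg: "0 \<le> f k" for k using assms c by (auto simp: f_def)
  have f_sums: "(\<lambda>k. f k * s ^ k) sums psi m r s" if s: "0 \<le> s" "s \<le> 1" for s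
  proof -
    have cs: "norm (c * s) < 1"
      using c s mult_left_le[of s c] by (simp add: abs_of_nonneg)
    have "(\<lambda>k. m / (1 + r)\<^sup>2 * s * (c * s) ^ k) sums (m / (1 + r)\<^sup>2 * s * (1 / (1 - c * s)))"
      by (intro sums_mult geometric_sums cs)
    hence "(\<lambda>k. f (Suc k) * s ^ Suc k) sums (m / (1 + r)\<^sup>2 * s * (1 / (1 - c * s)))"
      by (simp add: f_def power_mult_distrib mult_ac)
    hence 1: "(\<lambda>k. f k * s ^ k) sums (m / (1 + r)\<^sup>2 * s * (1 / (1 - c * s)) + f 0 * s ^ 0)"
      by (rule sums_Suc)
    have pos: "1 + r > 0" "1 + r * (1 - s) > 0"
      using assms s by (auto intro: add_pos_nonneg)
    have "1 - c * s = (1 + r * (1 - s)) / (1 + r)"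
      using pos by (simp add: c_def field_simps)
    hence "m / (1 + r)\<^sup>2 * s * (1 / (1 - c * s)) + f 0 * s ^ 0
             = m * s / ((1 + r) * (1 + r * (1 - s))) + (1 - m / (1 + r))"
      using pos by (simp add: f_def power2_eq_square)
    also have "\<dots> = psi m r s"
    proof -
      have "m * s / (a * b) + (1 - m / a) = 1 - m * ((1 - s) / b)"
        if "a > 0" "b > 0" "b = a - r * s" "a = 1 + r" for a b
        using that by (simp add: divide_simps) (simp add: algebra_simps)
      from this[of "1 + r" "1 + r * (1 - s)"] pos show ?thesis
        by (simp add: psi_def algebra_simps)
    qed
    finally show ?thesis using 1 by simp
  qed
  have "f sums 1" using f_sums[of 1] by (simp add: psi_def)
  hence f_int: "(\<integral>\<^sup>+k. ennreal (f k) \<partial>count_space UNIV) = 1"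
    by (simp add: nn_integral_count_space_nat suminf_ennreal2 f_nonneg sums_summable
          sums_unique[symmetric])
  define p where "p = embed_pmf f"
  have "pmf p k = f k" for k
    unfolding p_def by (rule pmf_embed_pmf[OF f_nonneg f_int])
  hence p: "\<forall>s\<in>{0..1}. pgf (measure_pmf p) s = psi m r s"
    using pgf_sums[of _ p] f_sums sums_unique2 by fastforce
  have "\<forall>s\<in>{0..1}. pgf (measure_pmf (BerG m r)) s = psi m r s"
    unfolding BerG_def
  proof (rule theI[of _ p])
    show "\<forall>s\<in>{0..1}. pgf (measure_pmf p) s = psi m r s" by (rule p)
  next
    fix q assume "\<forall>s\<in>{0..1}. pgf (measure_pmf q) s = psi m r s"
    with p show "q = p" by (intro pgf_eq_imp_eq) auto
  qed
  with assms show ?thesis by auto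
qed

end

theory Submission
  imports Defs
begin

text \<open>
  Write \<open>G Y\<close> for the pgf of a variable \<open>Y\<close> and \<open>\<psi>\<close> for \<open>psi m r\<close>. Conditioning on \<open>X 0\<close> gives the one-step
  identity \<open>G (X 1) s = G (X 0) (\<psi> s) * G (e 1) s\<close> (\<open>pgf_INAR_step\<close>). A law with pgf \<open>g\<close> therefore
  reproduces itself in one step if the innovations have pgf \<open>g s / g (\<psi> s)\<close>, and only then where
  \<open>g (\<psi> s)\<close> is nonzero. This settles both halves of the theorem.

  \<^item> Put \<open>u = 1 - s\<close>. Then \<open>psi m r s = (1 + (r - m) u) / (1 + r u)\<close>, and composing two such functions
    gives again a quotient of functions affine in \<open>u\<close> (\<open>psi_compose\<close>). For the marginal \<open>BerG m' r'\<close>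
    the quotient \<open>g s / g (\<psi> s)\<close> is the product of \<open>(1 + (r' - m') u) / (1 + (r + (r' - m') m) u)\<close> and
    \<open>(1 + (r + r' m) u) / (1 + r' u)\<close>; these are \<open>psi m1 r1 s\<close> and \<open>psi m2 r2 s\<close>. The hypotheses on
    \<open>m' - r'\<close> say that \<open>m1 > 0\<close>, \<open>r1 \<ge> 0\<close> and \<open>m1 \<le> r1 + 1\<close>, and \<open>r' \<ge> r / (1 - m)\<close> says that \<open>m2 \<ge> 0\<close>, so
    that both factors are pgfs.

  \<^item> Here \<open>g (\<psi> s)\<close> never vanishes on the unit interval, which forces the innovation law
    (\<open>INAR1_innovation_law\<close>).

  \<^item> For existence, take a product measure on \<open>source \<Rightarrow> nat\<close> and define \<open>X\<close> by the recursion (\<open>path\<close>).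
    Strict stationarity needs no computation of joint laws: the map that advances all sources by one
    time unit and takes \<open>X 1\<close> as the new initial value (\<open>restart\<close>) preserves the product measure,
    because \<open>X 1\<close> depends on sources that no other new coordinate uses and has the law of \<open>X 0\<close>
    by the one-step identity (\<open>distr_restart\<close>). As \<open>X (t + h)\<close> is \<open>X t\<close> composed with the \<open>h\<close>-th iterate
    of that map, the shifted process has the same joint laws as the original one.
\<close>

section \<open>Laws on the natural numbers and their generating functions\<close>

lemma pgf_law:
  assumes "Y \<in> measurable M (count_space UNIV)"
  shows "pgf (law M Y) s = (\<integral>\<omega>. s ^ Y \<omega> \<partial>M)"
  unfolding pgf_def law_def by (rule integral_distr) (use assms in auto)

text \<open>
  The uniqueness theorem for pgfs concerns values of type \<open>pmf\<close>; this transfers it to the law of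
  a random variable.
\<close>
lemma nat_law_eq_pmf:
  fixes N :: "nat measure"
  assumes "prob_space N" "sets N = UNIV"
  obtains p where "N = measure_pmf p"
proof -
  have sp: "space N = UNIV" using sets_eq_imp_space_eq[of N "count_space UNIV"] assms(2) by simp
  have "AE x in N. measure N {x} \<noteq> 0"
  proof (rule AE_I')
    show "(\<Union>x\<in>{x. measure N {x} = 0}. {x}) \<in> null_sets N"
      using assms
      by (intro null_sets_UN') (auto simp: null_sets_def prob_space.finite_measure finite_measure.emeasure_eq_measure)
  qed auto
  then show ?thesis using assms that[of "Abs_pmf N"] by (simp add: Abs_pmf_inverse)
qed

lemma law_eq_pmfI:
  fixes p :: "nat pmf"
  assumes "prob_space M" "Y \<in> measurable M (count_space UNIV)"
    and "\<And>s. 0 \<le> s \<Longrightarrow> s \<le> 1 \<Longrightarrow> pgf (law M Y) s = pgf (measure_pmf p) s"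
  shows "law M Y = measure_pmf p"
proof -
  have "prob_space (law M Y)" unfolding law_def using assms by (intro prob_space.prob_space_distr)
  moreover have "sets (law M Y) = UNIV" by (simp add: law_def)
  ultimately obtain p' where "law M Y = measure_pmf p'" by (rule nat_law_eq_pmf)
  with assms(3) show ?thesis using pgf_eq_imp_eq[of p' p] by simp
qed

lemma pgf_convolution_pmf:
  assumes "0 \<le> s" "s \<le> 1"
  shows "pgf (measure_pmf (convolution_pmf p q)) s = pgf (measure_pmf p) s * pgf (measure_pmf q) s"
proof -
  have int: "integrable (measure_pmf R) (\<lambda>k. s ^ f k)" for R :: "'b pmf" and f
    by (rule measure_pmf.integrable_const_bound[where B = 1])
       (use assms in \<open>auto simp: power_le_one abs_of_nonneg\<close>)
  have nn: "ennreal (\<integral>k. s ^ f k \<partial>measure_pmf R) = (\<integral>\<^sup>+k. ennreal (s ^ f k) \<partial>measure_pmf R)"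
    for R :: "'b pmf" and f
    by (rule nn_integral_eq_integral[symmetric]) (use assms int in auto)
  have "ennreal (pgf (measure_pmf (convolution_pmf p q)) s)
      = ennreal (\<integral>z. s ^ (fst z + snd z) \<partial>measure_pmf (pair_pmf p q))"
    by (simp add: pgf_def convolution_pmf_def case_prod_unfold)
  also have "\<dots> = (\<integral>\<^sup>+x. \<integral>\<^sup>+y. ennreal (s ^ x) * ennreal (s ^ y) \<partial>measure_pmf q \<partial>measure_pmf p)"
    unfolding nn using assms by (simp add: nn_integral_pair_pmf' power_add ennreal_mult)
  also have "\<dots> = ennreal (pgf (measure_pmf p) s) * ennreal (pgf (measure_pmf q) s)"
    unfolding pgf_def nn by (simp add: nn_integral_cmult nn_integral_multc)
  also have "\<dots> = ennreal (pgf (measure_pmf p) s * pgf (measure_pmf q) s)"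
    using assms by (simp add: ennreal_mult pgf_def)
  finally show ?thesis
    using assms by (subst (asm) ennreal_inj) (auto simp: pgf_def)
qed

section \<open>The functions \<psi>\<close>

text \<open>Immediate from the fact that \<open>\<psi>\<close> is the pgf of a BerG law.\<close>
lemma psi_in_unit:
  assumes "0 \<le> r" "0 \<le> m" "m \<le> r + 1" "0 \<le> s" "s \<le> 1"
  shows "psi m r s \<in> {0..1}"
  unfolding pgf_BerG[OF assms, symmetric]
proof -
  have "(\<integral>k. s ^ k \<partial>measure_pmf (BerG m r)) \<le> (\<integral>k. 1 \<partial>measure_pmf (BerG m r))"
    using assms
    by (intro integral_mono measure_pmf.integrable_const_bound[where B = 1])
       (auto simp: power_le_one abs_of_nonneg)
  thus "pgf (measure_pmf (BerG m r)) s \<in> {0..1}"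
    using assms by (simp add: pgf_def)
qed

lemma psi_eq_quotient:
  assumes "0 \<le> r" "s \<le> 1"
  shows "psi m r s = (1 + (r - m) * (1 - s)) / (1 + r * (1 - s))"
proof -
  have "1 + r * (1 - s) > 0" using assms by (simp add: add_pos_nonneg)
  thus ?thesis by (simp add: psi_def field_simps)
qed

text \<open>
  In the variable \<open>u = 1 - s\<close>, applying \<open>\<psi>\<^sub>m\<^sub>,\<^sub>r\<close> replaces \<open>u\<close> by \<open>m u / (1 + r u)\<close>; clearing the inner
  denominator \<open>1 + r u\<close> leaves a quotient of affine functions.
\<close>
lemma psi_compose:
  assumes "0 \<le> r" "0 \<le> m" "0 \<le> r'" "s \<le> 1"
  shows "psi m' r' (psi m r s)
       = (1 + (r + (r' - m') * m) * (1 - s)) / (1 + (r + r' * m) * (1 - s))"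
proof -
  define u where "u = 1 - s"
  define a where "a = 1 + r * u"
  have u: "0 \<le> u" using assms by (simp add: u_def)
  have a: "a > 0" using assms u by (simp add: a_def add_pos_nonneg)
  have v: "1 - psi m r s = m * u / a" by (simp add: psi_def u_def a_def)
  have "0 \<le> m * u / a" using assms u a by simp
  hence "psi m' r' (psi m r s) = (1 + (r' - m') * (m * u / a)) / (1 + r' * (m * u / a))"
    using assms v by (subst psi_eq_quotient) auto
  also have "\<dots> = (a * (1 + (r' - m') * (m * u / a))) / (a * (1 + r' * (m * u / a)))"
    using a by simp
  also have "a * (1 + (r' - m') * (m * u / a)) = 1 + (r + (r' - m') * m) * u"
    using a by (simp add: field_simps) (simp add: a_def algebra_simps)
  also have "a * (1 + r' * (m * u / a)) = 1 + (r + r' * m) * u"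
    using a by (simp add: field_simps) (simp add: a_def algebra_simps)
  finally show ?thesis by (simp add: u_def)
qed

section \<open>Random sums and the one-step identity\<close>

text \<open>
  This takes the place of conditioning on \<open>N\<close>: on the slice \<open>N = n\<close> a random sum becomes a finite
  one.
\<close>
lemma (in prob_space) expectation_sums_over_values:
  fixes N :: "'a \<Rightarrow> nat" and f :: "'a \<Rightarrow> real"
  assumes [measurable]: "N \<in> measurable M (count_space UNIV)" "f \<in> borel_measurable M"
    and bound: "\<And>\<omega>. \<bar>f \<omega>\<bar> \<le> B"
  shows "(\<lambda>n. expectation (\<lambda>\<omega>. indicator {n} (N \<omega>) * f \<omega>)) sums expectation f"
proof -
  have int: "integrable M (\<lambda>\<omega>. indicator A (N \<omega>) * f \<omega>)" for A
  proof (rule integrable_const_bound[where B = B])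
    have "\<bar>indicator A (N \<omega>) * f \<omega>\<bar> \<le> B" for \<omega>
      using bound[of \<omega>] by (auto simp: indicator_def)
    thus "AE \<omega> in M. norm (indicator A (N \<omega>) * f \<omega>) \<le> B" by simp
  qed measurable
  have "(\<Sum>n<k. expectation (\<lambda>\<omega>. indicator {n} (N \<omega>) * f \<omega>))
      = expectation (\<lambda>\<omega>. indicator {..<k} (N \<omega>) * f \<omega>)" for k
  proof -
    have "(\<Sum>n<k. indicator {n} (N \<omega>) * f \<omega>) = indicator {..<k} (N \<omega>) * f \<omega>" for \<omega>
    proof -
      have "indicator {n} (N \<omega>) * f \<omega> = (if N \<omega> = n then f \<omega> else 0)" for n
        by simp
      thus ?thesis by (simp only: sum.delta' finite_lessThan) simp
    qed
    moreover have "(\<Sum>n<k. expectation (\<lambda>\<omega>. indicator {n} (N \<omega>) * f \<omega>))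
        = expectation (\<lambda>\<omega>. \<Sum>n<k. indicator {n} (N \<omega>) * f \<omega>)"
      by (rule Bochner_Integration.integral_sum[symmetric]) (rule int)
    ultimately show ?thesis by (simp only:)
  qed
  moreover have "(\<lambda>k. expectation (\<lambda>\<omega>. indicator {..<k} (N \<omega>) * f \<omega>)) \<longlonglongrightarrow> expectation f"
  proof (rule integral_dominated_convergence[where w = "\<lambda>_. B"])
    have "\<forall>\<^sub>F k in sequentially. indicator {..<k} (N \<omega>) * f \<omega> = f \<omega>" for \<omega>
      using eventually_gt_at_top[of "N \<omega>"] by eventually_elim simp
    hence "(\<lambda>k. indicator {..<k} (N \<omega>) * f \<omega>) \<longlonglongrightarrow> f \<omega>" for \<omega>
      by (rule tendsto_eventually)
    thus "AE \<omega> in M. (\<lambda>k. indicator {..<k} (N \<omega>) * f \<omega>) \<longlonglongrightarrow> f \<omega>" by simp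
    have "norm (indicator {..<k} (N \<omega>) * f \<omega>) \<le> B" for k \<omega>
      using bound[of \<omega>] by (auto simp: indicator_def)
    thus "AE \<omega> in M. norm (indicator {..<k} (N \<omega>) * f \<omega>) \<le> B" for k by simp
  next
    show "(\<lambda>\<omega>. indicator {..<k} (N \<omega>) * f \<omega>) \<in> borel_measurable M" for k
      by (rule borel_measurable_integrable) (rule int)
  qed (use assms in simp_all)
  ultimately show ?thesis by (simp add: sums_def)
qed

lemma nat_measurable_random_sum:
  fixes N :: "'a \<Rightarrow> nat" and Z :: "nat \<Rightarrow> 'a \<Rightarrow> nat"
  assumes "N \<in> measurable M (count_space UNIV)"
    and "\<And>i. 1 \<le> i \<Longrightarrow> Z i \<in> measurable M (count_space UNIV)"
    and "Y \<in> measurable M (count_space UNIV)"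
  shows "(\<lambda>\<omega>. (\<Sum>i=1..N \<omega>. Z i \<omega>) + Y \<omega>) \<in> measurable M (count_space UNIV)"
proof (rule measurable_compose_countable'[where I = UNIV and g = N])
  fix n
  have eq: "measurable M (count_space (UNIV :: nat set)) = borel_measurable M"
    by (rule measurable_cong_sets[OF refl sets_borel_eq_count_space[symmetric]])
  show "(\<lambda>\<omega>. (\<Sum>i=1..n. Z i \<omega>) + Y \<omega>) \<in> measurable M (count_space UNIV)"
    using assms(2,3) unfolding eq
    by (intro borel_measurable_add borel_measurable_sum) auto
qed (use assms in auto)

text \<open>
  On \<open>Y a = n\<close> the integrand is a product of functions of the finitely many independent variables
  \<open>Y a\<close>, \<open>Y b\<close>, \<open>Y (c 1), \<dots>, Y (c n)\<close>, so its expectation factorises; summing over \<open>n\<close> gives the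
  pgf of \<open>Y a\<close> at \<open>q\<close>. All variables are drawn from one independent family, so that no
  independence between subfamilies has to be derived first.
\<close>
lemma (in prob_space) expectation_power_random_sum:
  fixes Y :: "'i \<Rightarrow> 'a \<Rightarrow> nat" and s q :: real
  assumes indep: "indep_vars (\<lambda>_. count_space UNIV) Y I"
    and ab: "a \<in> I" "b \<in> I" "a \<noteq> b"
    and c: "inj_on c {1..}" "c ` {1..} \<subseteq> I - {a, b}"
    and s: "0 \<le> s" "s \<le> 1"
    and q: "0 \<le> q" "q \<le> 1"
    and eq: "\<And>i. 1 \<le> i \<Longrightarrow> expectation (\<lambda>\<omega>. s ^ Y (c i) \<omega>) = q"
  shows "expectation (\<lambda>\<omega>. s ^ ((\<Sum>i=1..Y a \<omega>. Y (c i) \<omega>) + Y b \<omega>))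
       = expectation (\<lambda>\<omega>. q ^ Y a \<omega>) * expectation (\<lambda>\<omega>. s ^ Y b \<omega>)"
proof -
  have meas: "Y i \<in> measurable M (count_space UNIV)" if "i \<in> I" for i
    using indep that by (auto simp: indep_vars_def)
  have [measurable]: "Y a \<in> measurable M (count_space UNIV)" "Y b \<in> measurable M (count_space UNIV)"
    using ab meas by auto
  have [measurable]: "(\<lambda>\<omega>. (\<Sum>i=1..Y a \<omega>. Y (c i) \<omega>) + Y b \<omega>) \<in> measurable M (count_space UNIV)"
    by (rule nat_measurable_random_sum) (use c meas in auto)
  have pw: "0 \<le> x ^ n \<and> x ^ n \<le> 1" if "0 \<le> x" "x \<le> 1" for x :: real and n
    using that by (simp add: power_le_one)
  have slice: "expectation (\<lambda>\<omega>. indicator {n} (Y a \<omega>) * s ^ ((\<Sum>i=1..Y a \<omega>. Y (c i) \<omega>) + Y b \<omega>))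
      = expectation (\<lambda>\<omega>. indicator {n} (Y a \<omega>) * q ^ Y a \<omega>) * expectation (\<lambda>\<omega>. s ^ Y b \<omega>)" for n
  proof -
    define J where "J = insert a (insert b (c ` {1..n}))"
    \<comment> \<open>\<open>Y a\<close> contributes the indicator of the slice, every other variable its power of \<open>s\<close>.\<close>
    define g where "g i x = (if i = a then indicator {n} x else s ^ x)" for i and x :: nat
    have cI: "c ` {1..n} \<subseteq> I - {a, b}"
      using image_mono[of "{1..n}" "{1..}" c] c(2) by force
    hence J: "J \<subseteq> I" "finite J" using ab by (auto simp: J_def)
    have inj: "inj_on c {1..n}" using c(1) by (rule inj_on_subset) auto
    have prodJ: "(\<Prod>i\<in>J. h i) = h a * (h b * (\<Prod>i=1..n. h (c i)))" for h :: "'i \<Rightarrow> real"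
    proof -
      have "a \<notin> insert b (c ` {1..n})" "b \<notin> c ` {1..n}" using ab cI by auto
      thus ?thesis by (simp add: J_def prod.reindex[OF inj] del: One_nat_def)
    qed
    have ne: "c i \<noteq> a" if "i \<in> {1..n}" for i using cI imageI[OF that, of c] by blast
    have ind: "indep_vars (\<lambda>_. borel) (\<lambda>i \<omega>. g i (Y i \<omega>)) J"
      by (rule indep_vars_compose2[OF indep_vars_subset[OF indep J(1)]]) auto
    have gi: "integrable M (\<lambda>\<omega>. g i (Y i \<omega>))" if "i \<in> J" for i
    proof (rule integrable_const_bound[where B = 1])
      show "AE \<omega> in M. norm (g i (Y i \<omega>)) \<le> 1"
        using pw[OF s] by (auto simp: g_def indicator_def)
      show "(\<lambda>\<omega>. g i (Y i \<omega>)) \<in> borel_measurable M"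
        by (rule measurable_compose[OF meas]) (use that J in auto)
    qed
    have "expectation (\<lambda>\<omega>. indicator {n} (Y a \<omega>) * s ^ ((\<Sum>i=1..Y a \<omega>. Y (c i) \<omega>) + Y b \<omega>))
        = expectation (\<lambda>\<omega>. \<Prod>i\<in>J. g i (Y i \<omega>))"
    proof (rule Bochner_Integration.integral_cong[OF refl])
      fix \<omega>
      have "(\<Prod>i=1..n. g (c i) (Y (c i) \<omega>)) = s ^ (\<Sum>i=1..n. Y (c i) \<omega>)"
        using ne by (simp add: g_def power_sum)
      thus "indicator {n} (Y a \<omega>) * s ^ ((\<Sum>i=1..Y a \<omega>. Y (c i) \<omega>) + Y b \<omega>) = (\<Prod>i\<in>J. g i (Y i \<omega>))"
        using ab by (simp add: prodJ) (simp add: g_def indicator_def power_add)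
    qed
    also have "\<dots> = (\<Prod>i\<in>J. expectation (\<lambda>\<omega>. g i (Y i \<omega>)))"
      by (rule indep_vars_lebesgue_integral[OF J(2) ind gi])
    also have "\<dots> = expectation (\<lambda>\<omega>. indicator {n} (Y a \<omega>)) * q ^ n * expectation (\<lambda>\<omega>. s ^ Y b \<omega>)"
    proof -
      have "(\<Prod>i=1..n. expectation (\<lambda>\<omega>. g (c i) (Y (c i) \<omega>))) = q ^ n"
        using ne eq by (simp add: g_def)
      thus ?thesis using ab by (simp add: prodJ) (simp add: g_def)
    qed
    also have "expectation (\<lambda>\<omega>. indicator {n} (Y a \<omega>)) * q ^ n
        = expectation (\<lambda>\<omega>. indicator {n} (Y a \<omega>) * q ^ Y a \<omega>)"
    proof -
      have "indicator {n} (Y a \<omega>) * q ^ Y a \<omega> = indicator {n} (Y a \<omega>) * q ^ n" for \<omega>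
        by (simp add: indicator_def)
      thus ?thesis by (simp only: integral_mult_left_zero)
    qed
    finally show ?thesis .
  qed
  have "(\<lambda>n. expectation (\<lambda>\<omega>. indicator {n} (Y a \<omega>) * s ^ ((\<Sum>i=1..Y a \<omega>. Y (c i) \<omega>) + Y b \<omega>)))
      sums expectation (\<lambda>\<omega>. s ^ ((\<Sum>i=1..Y a \<omega>. Y (c i) \<omega>) + Y b \<omega>))"
  proof (rule expectation_sums_over_values[where B = 1])
    show "(\<lambda>\<omega>. s ^ ((\<Sum>i=1..Y a \<omega>. Y (c i) \<omega>) + Y b \<omega>)) \<in> borel_measurable M"
      by measurable
    show "\<bar>s ^ ((\<Sum>i=1..Y a \<omega>. Y (c i) \<omega>) + Y b \<omega>)\<bar> \<le> 1" for \<omega>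
      using pw[OF s] by (simp only: abs_of_nonneg)
  qed measurable
  moreover have "(\<lambda>n. expectation (\<lambda>\<omega>. indicator {n} (Y a \<omega>) * q ^ Y a \<omega>) * expectation (\<lambda>\<omega>. s ^ Y b \<omega>))
      sums (expectation (\<lambda>\<omega>. q ^ Y a \<omega>) * expectation (\<lambda>\<omega>. s ^ Y b \<omega>))"
    by (intro sums_mult2 expectation_sums_over_values[where B = 1]) (use pw[OF q] in auto)
  ultimately show ?thesis unfolding slice by (rule sums_unique2)
qed

lemma pgf_INAR_step:
  assumes "prob_space M"
    and indep: "prob_space.indep_vars M (\<lambda>_. count_space UNIV) W sources"
    and offspring: "\<And>i. 1 \<le> i \<Longrightarrow> pgf (law M (W (Offspring i 0))) s = q"
    and s: "0 \<le> s" "s \<le> 1" and q: "0 \<le> q" "q \<le> 1"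
  shows "pgf (law M (\<lambda>\<omega>. (\<Sum>i=1..W Initial \<omega>. W (Offspring i 0) \<omega>) + W (Innovation 1) \<omega>)) s
       = pgf (law M (W Initial)) q * pgf (law M (W (Innovation 1))) s"
proof -
  interpret prob_space M by fact
  have src: "Initial \<in> sources" "Innovation 1 \<in> sources" "\<And>i. 1 \<le> i \<Longrightarrow> Offspring i 0 \<in> sources"
    by (auto simp: sources_def)
  have meas: "W i \<in> measurable M (count_space UNIV)" if "i \<in> sources" for i
    using indep that by (auto simp: indep_vars_def)
  have "(\<lambda>\<omega>. (\<Sum>i=1..W Initial \<omega>. W (Offspring i 0) \<omega>) + W (Innovation 1) \<omega>)
      \<in> measurable M (count_space UNIV)"
    by (rule nat_measurable_random_sum) (use meas src in auto)
  moreover have "expectation (\<lambda>\<omega>. s ^ ((\<Sum>i=1..W Initial \<omega>. W (Offspring i 0) \<omega>) + W (Innovation 1) \<omega>))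
       = expectation (\<lambda>\<omega>. q ^ W Initial \<omega>) * expectation (\<lambda>\<omega>. s ^ W (Innovation 1) \<omega>)"
    by (rule expectation_power_random_sum[OF indep])
       (use src s q offspring meas in \<open>auto simp: inj_on_def pgf_law[symmetric]\<close>)
  ultimately show ?thesis using meas src by (simp add: pgf_law)
qed

section \<open>The innovation law is determined by the marginal\<close>

text \<open>
  When \<open>X 0\<close> and \<open>X 1\<close> both have law \<open>p\<close>, the one-step identity can be solved for the pgf of \<open>e 1\<close>, as
  the other factor does not vanish.
\<close>
lemma INAR1_innovation_law:
  fixes p q :: "nat pmf"
  assumes mr: "0 \<le> r" "0 \<le> m" "m \<le> r + 1"
    and inar: "INAR1 m r M X Z e"
    and marg: "law M (X 0) = measure_pmf p" "law M (X 1) = measure_pmf p"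
    and fac: "\<And>s. 0 \<le> s \<Longrightarrow> s \<le> 1 \<Longrightarrow>
      pgf (measure_pmf p) s = pgf (measure_pmf p) (psi m r s) * pgf (measure_pmf q) s"
    and nz: "\<And>s. 0 \<le> s \<Longrightarrow> s \<le> 1 \<Longrightarrow> pgf (measure_pmf p) (psi m r s) \<noteq> 0"
    and t: "1 \<le> t"
  shows "law M (e t) = measure_pmf q"
proof -
  have ps: "prob_space M"
    and indep: "prob_space.indep_vars M (\<lambda>_. count_space UNIV) (driving X Z e) sources"
    and Z: "\<And>i t s. 1 \<le> i \<Longrightarrow> 0 \<le> s \<Longrightarrow> s \<le> 1 \<Longrightarrow> pgf (law M (Z i t)) s = psi m r s"
    and e: "law M (e t) = law M (e 1)"
    and rec: "\<forall>t\<ge>1. \<forall>\<omega>\<in>space M. X t \<omega> = (\<Sum>i=1..X (t - 1) \<omega>. Z i (t - 1) \<omega>) + e t \<omega>"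
    using inar t unfolding INAR1_def atLeastAtMost_iff Ball_def by blast+
  have X1: "X 1 \<omega> = (\<Sum>i=1..X 0 \<omega>. Z i 0 \<omega>) + e 1 \<omega>" if "\<omega> \<in> space M" for \<omega>
    using rec[rule_format, of 1 \<omega>] that by simp
  have em: "e 1 \<in> measurable M (count_space UNIV)"
  proof -
    have "Innovation 1 \<in> sources" by (auto simp: sources_def)
    with indep have "driving X Z e (Innovation 1) \<in> measurable M (count_space UNIV)"
      unfolding prob_space.indep_vars_def[OF ps] by blast
    thus ?thesis by simp
  qed
  have lawX1: "law M (X 1) = law M (\<lambda>\<omega>. (\<Sum>i=1..X 0 \<omega>. Z i 0 \<omega>) + e 1 \<omega>)"
    unfolding law_def by (rule distr_cong) (use X1 in auto)
  have "law M (e 1) = measure_pmf q"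
  proof (rule law_eq_pmfI[OF ps em])
    fix s :: real assume s: "0 \<le> s" "s \<le> 1"
    have "pgf (measure_pmf p) s = pgf (law M (X 1)) s" by (simp only: marg)
    also have "\<dots> = pgf (law M (X 0)) (psi m r s) * pgf (law M (e 1)) s"
      unfolding lawX1 using pgf_INAR_step[OF ps indep, of s "psi m r s"] Z s psi_in_unit[OF mr s] by simp
    finally have "pgf (measure_pmf p) (psi m r s) * pgf (law M (e 1)) s
        = pgf (measure_pmf p) (psi m r s) * pgf (measure_pmf q) s"
      using fac[OF s] marg(1) by (simp only:)
    thus "pgf (law M (e 1)) s = pgf (measure_pmf q) s" using nz[OF s] by simp
  qed
  with e show ?thesis by simp
qed

section \<open>The process as a function of its sources\<close>

primrec path :: "nat \<Rightarrow> (source \<Rightarrow> nat) \<Rightarrow> nat" where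
  "path 0 w = w Initial"
| "path (Suc t) w = (\<Sum>i=1..path t w. w (Offspring i t)) + w (Innovation (Suc t))"

text \<open>
  The sources of the process as seen from time 1 onwards. The label \<open>Innovation 0\<close> drives nothing; it
  is left in place, since shifting it would make it \<open>w (Innovation 1)\<close>, which is already consumed by
  the new initial value, and the coordinates of \<open>restart w\<close> would not be independent.
\<close>
fun restart :: "(source \<Rightarrow> nat) \<Rightarrow> source \<Rightarrow> nat" where
  "restart w Initial = path 1 w"
| "restart w (Innovation t) = w (Innovation (if t = 0 then 0 else Suc t))"
| "restart w (Offspring i t) = w (Offspring i (Suc t))"

lemma path_restart: "path t (restart w) = path (Suc t) w"
  by (induction t) auto

lemma path_restart_iterate: "path (t + h) w = path t ((restart ^^ h) w)"
proof (induction h arbitrary: w)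
  case (Suc h)
  show ?case
    using Suc[of "restart w"] path_restart[of "t + h" w] by (simp add: funpow_swap1 del: path.simps)
qed simp

fun source_pmf :: "nat pmf \<Rightarrow> nat pmf \<Rightarrow> nat pmf \<Rightarrow> source \<Rightarrow> nat pmf" where
  "source_pmf p z q Initial = p"
| "source_pmf p z q (Offspring i t) = z"
| "source_pmf p z q (Innovation t) = q"

lemma measurable_path:
  assumes "\<And>j. (\<lambda>w. w j) \<in> measurable P (count_space UNIV)"
  shows "path t \<in> measurable P (count_space UNIV)"
proof (induction t)
  case (Suc t)
  thus ?case unfolding path.simps by (intro nat_measurable_random_sum assms)
qed (simp add: assms)

text \<open>
  Pairwise disjoint blocks of labels such that a coordinate of \<open>restart w\<close> depends on \<open>w\<close> only through
  its block.
\<close>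
fun restart_sources :: "source \<Rightarrow> source set" where
  "restart_sources Initial = {Initial, Innovation 1} \<union> range (\<lambda>i. Offspring i 0)"
| "restart_sources (Innovation t) = {Innovation (if t = 0 then 0 else Suc t)}"
| "restart_sources (Offspring i t) = {Offspring i (Suc t)}"

lemma disjoint_restart_sources: "disjoint_family restart_sources"
  unfolding disjoint_family_on_def
proof safe
  fix a b x assume *: "a \<noteq> b" "x \<in> restart_sources a" "x \<in> restart_sources b"
  show "x \<in> {}"
    using * by (cases a; cases b) (auto split: if_splits)
qed

lemma restart_local:
  "restart w j = restart (\<lambda>k. if k \<in> restart_sources j then w k else 0) j"
  by (cases j) (auto intro!: sum.cong)

section \<open>Existence of a stationary process\<close>

lemma PiM_pmf_coordinates:
  fixes D :: "'i \<Rightarrow> 'b pmf"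
  defines "P \<equiv> PiM UNIV (\<lambda>j. measure_pmf (D j))"
  shows "prob_space P"
    and "\<And>j. (\<lambda>w. w j) \<in> measurable P (count_space UNIV)"
    and "\<And>j. distr P (count_space UNIV) (\<lambda>w. w j) = measure_pmf (D j)"
    and "prob_space.indep_vars P (\<lambda>_. count_space UNIV) (\<lambda>j w. w j) UNIV"
proof -
  show ps: "prob_space P" unfolding P_def by (intro prob_space_PiM prob_space_measure_pmf)
  then interpret prob_space P .
  show meas: "(\<lambda>w. w j) \<in> measurable P (count_space UNIV)" for j
    unfolding P_def
    using measurable_component_singleton[of j UNIV "\<lambda>j. measure_pmf (D j)"]
    by (simp cong: measurable_cong_sets)
  show comp: "distr P (count_space UNIV) (\<lambda>w. w j) = measure_pmf (D j)" for j
  proof -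
    have "distr P (measure_pmf (D j)) (\<lambda>w. w j) = measure_pmf (D j)"
      unfolding P_def by (rule distr_PiM_component) (auto intro: prob_space_measure_pmf)
    moreover have "distr P (count_space UNIV) (\<lambda>w. w j) = distr P (measure_pmf (D j)) (\<lambda>w. w j)"
      by (rule distr_cong) auto
    ultimately show ?thesis by simp
  qed
  have S: "sets P = sets (PiM UNIV (\<lambda>_. count_space UNIV))"
    unfolding P_def by (intro sets_PiM_cong) auto
  show "indep_vars (\<lambda>_. count_space UNIV) (\<lambda>j w. w j) UNIV"
  proof (subst indep_vars_iff_distr_eq_PiM')
    show "distr P (PiM UNIV (\<lambda>_. count_space UNIV)) (\<lambda>x. \<lambda>i\<in>UNIV. x i)
        = PiM UNIV (\<lambda>i. distr P (count_space UNIV) (\<lambda>w. w i))"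
      unfolding comp using distr_id2[OF S[symmetric]] by (simp add: P_def restrict_UNIV)
  qed (use meas in auto)
qed

text \<open>
  The coordinates of \<open>restart w\<close> read disjoint blocks of independent sources and are therefore
  independent; as each has the marginal law that the product measure prescribes, their joint law is
  again that product measure. For the initial coordinate the marginal is the hypothesis \<open>step\<close>.
\<close>
lemma distr_restart:
  fixes p z q :: "nat pmf"
  defines "P \<equiv> PiM UNIV (\<lambda>j. measure_pmf (source_pmf p z q j))"
  assumes step: "law P (path 1) = measure_pmf p"
  shows "restart \<in> measurable P P" and "distr P P restart = P"
proof -
  note coord = PiM_pmf_coordinates[where D = "source_pmf p z q", folded P_def]
  interpret prob_space P by (rule coord(1))
  have S: "sets P = sets (PiM UNIV (\<lambda>_. count_space UNIV))"
    unfolding P_def by (intro sets_PiM_cong) auto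
  have rj: "(\<lambda>w. restart w j) \<in> measurable P (count_space UNIV)" for j
    by (cases j) (use measurable_path[OF coord(2), where t = 1] coord(2) in \<open>auto simp del: path.simps\<close>)
  have "(\<lambda>w. \<lambda>j\<in>UNIV. restart w j) \<in> measurable P (PiM UNIV (\<lambda>_. count_space UNIV))"
    by (intro measurable_restrict rj)
  hence "restart \<in> measurable P (PiM UNIV (\<lambda>_. count_space UNIV))" by (simp add: restrict_UNIV)
  thus "restart \<in> measurable P P" by (simp add: measurable_cong_sets[OF refl S])
  have marg: "distr P (count_space UNIV) (\<lambda>w. restart w j) = measure_pmf (source_pmf p z q j)" for j
    using step by (cases j) (auto simp: coord(3) law_def simp del: path.simps)
  have "indep_vars (\<lambda>j. PiM (restart_sources j) (\<lambda>_. count_space UNIV))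
      (\<lambda>j w. restrict (\<lambda>k. w k) (restart_sources j)) UNIV"
    by (rule indep_vars_restrict[OF coord(4)]) (use disjoint_restart_sources in auto)
  \<comment> \<open>A configuration on one block is extended by 0 to all labels before \<open>restart\<close> is applied.\<close>
  hence "indep_vars (\<lambda>_. count_space UNIV) (\<lambda>j w. restart (\<lambda>k. if k \<in> restart_sources j
        then restrict (\<lambda>k. w k) (restart_sources j) k else 0) j) UNIV"
  proof (rule indep_vars_compose2)
    fix j
    let ?Q = "PiM (restart_sources j) (\<lambda>_. count_space (UNIV :: nat set))"
    let ?ext = "\<lambda>v k. if k \<in> restart_sources j then v k else (0 :: nat)"
    have "(\<lambda>v. ?ext v k) \<in> measurable ?Q (count_space UNIV)" for k
      by (cases "k \<in> restart_sources j") auto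
    hence "?ext \<in> measurable ?Q (PiM UNIV (\<lambda>_. count_space UNIV))"
      by (intro measurable_PiM_single') (auto simp: space_PiM)
    hence "?ext \<in> measurable ?Q P" by (simp add: measurable_cong_sets[OF refl S])
    thus "(\<lambda>v. restart (?ext v) j) \<in> measurable ?Q (count_space UNIV)"
      using measurable_compose[OF _ rj] by blast
  qed
  moreover have "restart (\<lambda>k. if k \<in> restart_sources j then restrict (\<lambda>k. w k) (restart_sources j) k else 0) j
      = restart w j" for j w
    by (subst (2) restart_local) (simp cong: if_cong)
  ultimately have "indep_vars (\<lambda>_. count_space UNIV) (\<lambda>j w. restart w j) UNIV" by simp
  hence "distr P (PiM UNIV (\<lambda>_. count_space UNIV)) (\<lambda>w. \<lambda>j\<in>UNIV. restart w j)
      = PiM UNIV (\<lambda>j. distr P (count_space UNIV) (\<lambda>w. restart w j))"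
    by (subst (asm) indep_vars_iff_distr_eq_PiM') (use rj in auto)
  hence "distr P (PiM UNIV (\<lambda>_. count_space UNIV)) restart = P"
    unfolding marg by (simp add: restrict_UNIV P_def)
  thus "distr P P restart = P" using S by (simp cong: distr_cong)
qed

text \<open>
  The product measure makes the sources independent by construction; the factorisation of the pgf of
  \<open>p\<close> is what makes \<open>X\<^sub>1\<close> distributed as \<open>X\<^sub>0\<close>, and invariance under \<open>restart\<close> propagates this to all
  joint laws.
\<close>
lemma stationary_INAR1_exists:
  fixes p q :: "nat pmf"
  assumes mr: "0 \<le> r" "0 \<le> m" "m \<le> r + 1"
    and fac: "\<And>s. 0 \<le> s \<Longrightarrow> s \<le> 1 \<Longrightarrow>
      pgf (measure_pmf p) s = pgf (measure_pmf p) (psi m r s) * pgf (measure_pmf q) s"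
  shows "\<exists>(M :: (source \<Rightarrow> nat) measure) X Z e.
    INAR1 m r M X Z e \<and> strictly_stationary M X \<and>
    (\<forall>t. law M (X t) = measure_pmf p) \<and> (\<forall>t\<ge>1. law M (e t) = measure_pmf q)"
proof -
  define D where "D = source_pmf p (BerG m r) q"
  define P where "P = PiM UNIV (\<lambda>j. measure_pmf (D j))"
  define Z :: "nat \<Rightarrow> nat \<Rightarrow> (source \<Rightarrow> nat) \<Rightarrow> nat" where "Z i t w = w (Offspring i t)" for i t w
  define e :: "nat \<Rightarrow> (source \<Rightarrow> nat) \<Rightarrow> nat" where "e t w = w (Innovation t)" for t w
  note coord = PiM_pmf_coordinates[where D = D, folded P_def]
  interpret prob_space P by (rule coord(1))
  have lawj: "law P (\<lambda>w. w j) = measure_pmf (D j)" for j by (simp add: law_def coord(3))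
  have pm: "path t \<in> measurable P (count_space UNIV)" for t
    by (rule measurable_path) (rule coord(2))
  have ind: "indep_vars (\<lambda>_. count_space UNIV) (\<lambda>j w. w j) sources"
    by (rule indep_vars_subset[OF coord(4)]) auto
  have drv: "driving path Z e = (\<lambda>j w. w j)"
  proof
    show "driving path Z e j = (\<lambda>w. w j)" for j by (cases j) (auto simp: Z_def e_def fun_eq_iff)
  qed
  have step: "law P (path 1) = measure_pmf p"
  proof (rule law_eq_pmfI[OF coord(1) pm])
    fix s :: real assume s: "0 \<le> s" "s \<le> 1"
    have "pgf (law P (\<lambda>w. (\<Sum>i=1..w Initial. w (Offspring i 0)) + w (Innovation 1))) s
        = pgf (law P (\<lambda>w. w Initial)) (psi m r s) * pgf (law P (\<lambda>w. w (Innovation 1))) s"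
      by (rule pgf_INAR_step[OF coord(1) ind])
         (use s mr psi_in_unit[OF mr s] in \<open>auto simp: lawj D_def pgf_BerG\<close>)
    moreover have "path 1 = (\<lambda>w. (\<Sum>i=1..w Initial. w (Offspring i 0)) + w (Innovation 1))"
      by (simp add: fun_eq_iff)
    ultimately show "pgf (law P (path 1)) s = pgf (measure_pmf p) s"
      using fac[OF s] by (simp add: lawj D_def del: path.simps)
  qed
  note restart = distr_restart[of p "BerG m r" q, folded D_def, folded P_def, OF step]
  have iter: "restart ^^ h \<in> measurable P P \<and> distr P P (restart ^^ h) = P" for h
  proof (induction h)
    case (Suc h)
    have "distr P P (restart \<circ> restart ^^ h) = distr (distr P P (restart ^^ h)) P restart"
      using Suc restart by (intro distr_distr[symmetric]) auto
    thus ?case using Suc restart by (auto intro: measurable_comp simp: comp_def)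
  qed (simp add: distr_id[unfolded id_def] id_def)
  have stat: "strictly_stationary P path"
    unfolding strictly_stationary_def
  proof (intro allI impI)
    fix J :: "nat set" and h :: nat
    let ?Q = "PiM J (\<lambda>_. count_space (UNIV :: nat set))"
    have F: "(\<lambda>w. \<lambda>t\<in>J. path t w) \<in> measurable P ?Q" by (intro measurable_restrict pm)
    have "distr P ?Q (\<lambda>w. \<lambda>t\<in>J. path (t + h) w) = distr P ?Q ((\<lambda>w. \<lambda>t\<in>J. path t w) \<circ> restart ^^ h)"
      by (simp add: path_restart_iterate comp_def)
    also have "\<dots> = distr (distr P P (restart ^^ h)) ?Q (\<lambda>w. \<lambda>t\<in>J. path t w)"
      using F iter by (intro distr_distr[symmetric]) auto
    finally show "distr P ?Q (\<lambda>w. \<lambda>t\<in>J. path (t + h) w) = distr P ?Q (\<lambda>w. \<lambda>t\<in>J. path t w)"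
      using iter by simp
  qed
  have marg: "law P (path t) = measure_pmf p" for t
  proof -
    have "law P (path t) = law P (path 0 \<circ> restart ^^ t)"
      by (rule arg_cong[where f = "law P"]) (use path_restart_iterate[of 0 t] in \<open>simp add: fun_eq_iff\<close>)
    also have "\<dots> = law (distr P P (restart ^^ t)) (path 0)"
      unfolding law_def using iter pm by (intro distr_distr[symmetric]) auto
    also have "\<dots> = measure_pmf p" using iter lawj[of Initial] by (simp add: D_def path.simps(1)[abs_def])
    finally show ?thesis .
  qed
  have lawZ: "law P (Z i t) = measure_pmf (BerG m r)" and lawe: "law P (e t) = measure_pmf q" for i t
    using lawj[of "Offspring i t"] lawj[of "Innovation t"] by (simp_all add: D_def Z_def[abs_def] e_def[abs_def])
  have rec: "path t w = (\<Sum>i=1..path (t - 1) w. Z i (t - 1) w) + e t w" if "1 \<le> t" for t w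
    using that by (cases t) (auto simp: Z_def e_def)
  have "INAR1 m r P path Z e"
    unfolding INAR1_def drv
    by (intro conjI ballI allI impI coord(1) pm ind rec) (use mr in \<open>simp_all add: lawZ lawe pgf_BerG\<close>)
  with stat marg lawe show ?thesis by blast
qed

theorem proposition3p6:
  fixes m r m' r' m1 r1 m2 r2 :: real
  assumes "(m, r) \<in> param_R1"
    and "(m', r') \<in> param_R"
    and "- r / (1 - m) < m' - r'"
    and "m' - r' \<le> min (r / m) 1"
    and "r' \<ge> r / (1 - m)"
    and "(m1, r1) = (r + (r' - m') * (m - 1), r + (r' - m') * m)"
    and "(m2, r2) = (r' * (1 - m) - r, r')"
  shows
    "(\<exists>(M :: (source \<Rightarrow> nat) measure) X Z e.
        INAR1 m r M X Z e \<and> strictly_stationary M X \<and>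
        (\<forall>t. law M (X t) = measure_pmf (BerG m' r')) \<and>
        (\<forall>t\<ge>1. law M (e t) = measure_pmf (convolution_pmf (BerG m1 r1) (BerG m2 r2)))) \<and>
     (\<forall>(M :: 'a measure) X Z e.
        INAR1 m r M X Z e \<and> strictly_stationary M X \<and>
        (\<forall>t. law M (X t) = measure_pmf (BerG m' r')) \<longrightarrow>
        (\<forall>t\<ge>1. law M (e t) = measure_pmf (convolution_pmf (BerG m1 r1) (BerG m2 r2)))) \<and>
     (r' = r / (1 - m) \<longrightarrow> BerG m2 r2 = return_pmf 0)"
proof -
  have m: "0 \<le> r" "0 < m" "m < 1" and m': "0 \<le> r'" "0 < m'" "m' \<le> r' + 1"
    using assms(1,2) by (auto simp: param_R1_def param_R_def)
  have mr: "0 \<le> r" "0 \<le> m" "m \<le> r + 1" using m by auto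
  have eqs: "m1 = r + (r' - m') * (m - 1)" "r1 = r + (r' - m') * m"
    "m2 = r' * (1 - m) - r" "r2 = r'" using assms(6,7) by auto
  have r1: "0 \<le> r1" using assms(4) m by (simp add: eqs field_simps)
  have m1: "0 \<le> m1" using assms(3) m by (simp add: eqs field_simps)
  have m1': "m1 \<le> r1 + 1" using m' by (simp add: eqs algebra_simps)
  have m2: "0 \<le> m2" using assms(5) m by (simp add: eqs field_simps)
  have m2': "m2 \<le> r2 + 1"
    using m m' mult_nonneg_nonneg[of r' m] by (simp add: eqs algebra_simps)
  have r2: "0 \<le> r2" using m' eqs by simp
  let ?p = "BerG m' r'" and ?q = "convolution_pmf (BerG m1 r1) (BerG m2 r2)"
  have pp: "pgf (measure_pmf ?p) (psi m r s) = (1 + r1 * (1 - s)) / (1 + (r2 - m2) * (1 - s))"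
    if s: "0 \<le> s" "s \<le> 1" for s
  proof -
    have "pgf (measure_pmf ?p) (psi m r s) = psi m' r' (psi m r s)"
      using psi_in_unit[OF mr s] m' by (intro pgf_BerG) auto
    also have "\<dots> = (1 + r1 * (1 - s)) / (1 + (r2 - m2) * (1 - s))"
      using psi_compose[of r m r' s m'] mr m' s by (simp add: eqs algebra_simps)
    finally show ?thesis .
  qed
  have r2m2: "0 \<le> r2 - m2" using m m' by (simp add: eqs algebra_simps)
  have pos: "1 + x * (1 - s) > 0" if "0 \<le> x" "s \<le> 1" for x s :: real
    using that by (simp add: add_pos_nonneg)
  have nz: "pgf (measure_pmf ?p) (psi m r s) \<noteq> 0" if s: "0 \<le> s" "s \<le> 1" for s
    using pos[OF r1 s(2)] pos[OF r2m2 s(2)] by (simp add: pp[OF s])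
  \<comment> \<open>With \<open>r\<^sub>1 - m\<^sub>1 = r' - m'\<close> and \<open>r\<^sub>2 = r'\<close>, the factors \<open>1 + r\<^sub>1 u\<close> and \<open>1 + (r\<^sub>2 - m\<^sub>2) u\<close> cancel.\<close>
  have fac: "pgf (measure_pmf ?p) s = pgf (measure_pmf ?p) (psi m r s) * pgf (measure_pmf ?q) s"
    if s: "0 \<le> s" "s \<le> 1" for s
  proof -
    have "r1 - m1 = r' - m'" by (simp add: eqs algebra_simps)
    thus ?thesis
      using pos[OF r1 s(2)] pos[OF r2m2 s(2)] m' s r1 m1 m1' r2 m2 m2'
      by (simp add: pp[OF s] pgf_convolution_pmf pgf_BerG psi_eq_quotient)
         (simp add: eqs(4))
  qed
  have degenerate: "BerG m2 r2 = return_pmf 0" if "r' = r / (1 - m)"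
  proof (rule pgf_eq_imp_eq)
    fix s :: real assume s: "0 \<le> s" "s \<le> 1"
    have "m2 = 0" using that m by (simp add: eqs)
    thus "pgf (measure_pmf (BerG m2 r2)) s = pgf (measure_pmf (return_pmf 0)) s"
      using pgf_BerG[OF r2 m2 m2' s] by (simp add: psi_def pgf_def)
  qed
  have unique: "\<forall>t\<ge>1. law M (e t) = measure_pmf ?q"
    if "INAR1 m r M X Z e \<and> strictly_stationary M X \<and> (\<forall>t. law M (X t) = measure_pmf ?p)"
    for M :: "'a measure" and X Z e
    using that by (intro allI impI INAR1_innovation_law[OF mr _ _ _ fac nz]) auto
  show ?thesis
    using stationary_INAR1_exists[OF mr fac] unique degenerate by (intro conjI) blast+
qed

end
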